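(* For $s \in (0,1)$ and $n \ge 1$, let $\mathbf{G} \sim G(n,1/2)$ and let $\mathbf{G}'$ be the random graph obtained from $\mathbf{G}$ by re-sampling each edge independently with probability $s$. Let $\mu_{\mathbf{G}}, \mu_{\mathbf{G}'}$ denote the hardcore models at fugacity $\lambda = 1$ on $\mathbf{G}, \mathbf{G}'$ respectively, and let $w_2$ be the normalized $2$-Wasserstein distance. Then $$\lim_{s \to 0}\ \liminf_{n \to \infty}\ \mathbb{E}_{\mathbf{G},\mathbf{G}'}\left[ w_2(\mu_{\mathbf{G}},\mu_{\mathbf{G}'})^2 \right] = 2.$$
   Context: $G(n,1/2)$ is the Erdős–Rényi random graph on vertex set $[n]=\{1,\dots,n\}$, each of the $\binom n2$ potential edges being present independently with probability $1/2$. Re-sampling each edge with probability $s$ means: independently for each unordered pair of vertices, with probability $s$ the edge indicator of that pair is replaced by a fresh independent Bernoulli$(1/2)$ variable, and otherwise it is left unchanged; equivalently, each pair's edge indicator is flipped independently with probability $s/2$. The hardcore model on a graph $G$ with vertex set $[n]$ at fugacity $\lambda=1$ is the uniform distribution $\mu_G$ over all independent sets of $G$ (including the empty set). It is regarded as a probability measure on $\{0,1\}^n \subset \mathbb{R}^n$ by identifying a set $S\subseteq[n]$ with its indicator vector. For probability measures $\mu,\nu$ on a Euclidean space with norm $\|\cdot\|$, the normalized $2$-Wasserstein distance is $$w_2(\mu,\nu) = \inf_{\pi \in C(\mu,\nu)} \sqrt{ \mathbb{E}_{(X,Y)\sim\pi} \left\| \frac{X}{\sqrt{\mathbb{E}_{X\sim\mu}\|X\|^2}}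 - \frac{Y}{\sqrt{\mathbb{E}_{Y\sim\nu}\|Y\|^2}} \right\|^2 },$$ where $C(\mu,\nu)$ is the set of all couplings of $\mu$ and $\nu$. *)

theory Defs
  imports "HOL-Probability.Probability"
begin

text \<open>A graph on \<open>{1..n}\<close> is given by its edge indicator \<open>g\<close> on two-element subsets;
  values of \<open>g\<close> elsewhere are irrelevant (the random graphs below are \<open>False\<close> there).\<close>

definition vertex_pairs :: "nat \<Rightarrow> nat set set" where
  "vertex_pairs n = {e. e \<subseteq> {1..n} \<and> card e = 2}"

definition erdos_renyi_half :: "nat \<Rightarrow> (nat set \<Rightarrow> bool) pmf" where
  "erdos_renyi_half n = Pi_pmf (vertex_pairs n) False (\<lambda>_. bernoulli_pmf (1/2))"

definition resample :: "nat \<Rightarrow> real \<Rightarrow> (nat set \<Rightarrow> bool) \<Rightarrow> (nat set \<Rightarrow> bool) pmf" where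
  "resample n s g = Pi_pmf (vertex_pairs n) False
     (\<lambda>e. bind_pmf (bernoulli_pmf s)
            (\<lambda>b. if b then bernoulli_pmf (1/2) else return_pmf (g e)))"

definition resampled_pair ::
    "nat \<Rightarrow> real \<Rightarrow> ((nat set \<Rightarrow> bool) \<times> (nat set \<Rightarrow> bool)) pmf" where
  "resampled_pair n s =
     bind_pmf (erdos_renyi_half n) (\<lambda>g. map_pmf (\<lambda>g'. (g, g')) (resample n s g))"

definition independent_sets :: "nat \<Rightarrow> (nat set \<Rightarrow> bool) \<Rightarrow> nat set set" where
  "independent_sets n g =
     {S. S \<subseteq> {1..n} \<and> (\<forall>u\<in>S. \<forall>v\<in>S. u \<noteq> v \<longrightarrow> \<not> g {u, v})}"

text \<open>Since \<open>n\<close> varies, \<open>n\<close>-dimensional Euclidean space is the product of \<open>n\<close> copies of the real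
  line indexed by \<open>{1..n}\<close>, with Euclidean norm \<open>\<lambda>x. L2_set x {1..n}\<close>. Its points are the
  functions that are \<open>undefined\<close> outside \<open>{1..n}\<close>, hence the restricted abstraction below.\<close>

definition euclidean_borel :: "nat \<Rightarrow> (nat \<Rightarrow> real) measure" where
  "euclidean_borel n = PiM {1..n} (\<lambda>_. borel)"

definition hardcore :: "nat \<Rightarrow> (nat set \<Rightarrow> bool) \<Rightarrow> (nat \<Rightarrow> real) measure" where
  "hardcore n g =
     distr (measure_pmf (pmf_of_set (independent_sets n g))) (euclidean_borel n)
       (\<lambda>S. \<lambda>i\<in>{1..n}. indicator S i)"

definition couplings :: "'a measure \<Rightarrow> 'b measure \<Rightarrow> ('a \<times> 'b) measure set" where
  "couplings \<mu> \<nu> = {\<pi>. prob_space \<pi> \<and> sets \<pi> = sets (\<mu> \<Otimes>\<^sub>M \<nu>) \<and>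
                        distr \<pi> \<mu> fst = \<mu> \<and> distr \<pi> \<nu> snd = \<nu>}"

definition second_moment :: "nat \<Rightarrow> (nat \<Rightarrow> real) measure \<Rightarrow> real" where
  "second_moment n \<mu> = (\<integral>x. (L2_set x {1..n})\<^sup>2 \<partial>\<mu>)"

text \<open>Intended for probability measures \<open>\<mu>\<close>, \<open>\<nu>\<close> on \<open>euclidean_borel n\<close> with finite nonzero
  second moments; the infimum is then over a nonempty set of nonnegative reals, and all
  integrands are integrable.\<close>

definition w2 :: "nat \<Rightarrow> (nat \<Rightarrow> real) measure \<Rightarrow> (nat \<Rightarrow> real) measure \<Rightarrow> real" where
  "w2 n \<mu> \<nu> = (INF \<pi>\<in>couplings \<mu> \<nu>.
     sqrt (\<integral>(x, y). (L2_set (\<lambda>i. x i / sqrt (second_moment n \<mu>) -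
                                     y i / sqrt (second_moment n \<nu>)) {1..n})\<^sup>2 \<partial>\<pi>))"

end

(* Fix s in (0,1); the expectation already converges to 2 as n tends to infinity.  Writing
   w2^2 = 2 - 2 sup E<X,Y> / sqrt(M M') with M, M' the mean sizes of the independent sets, the
   upper bound is <X,Y> >= 0.  For the lower bound, let S and S' be independent in G and G'.  If
   S and S' meet in at least t points, then S has a t-subset that is independent in G' too; given
   G, each t-subset of S survives the resampling with probability (1 - s/2)^(t choose 2).  As
   |S| <= a = O(log n) with high probability, the expected number of surviving subsets is at most
   2^a (1 - s/2)^(t choose 2), which vanishes for t = (log n)^(3/4).  So under every coupling
   E<X,Y> = o(log n), whereas M and M' are at least of order log n: with high probability every
   vertex set of size below k (about (log2 n)/4) has at least 2k common non-neighbours, hence the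
   number of independent sets of size j at least doubles from j to j + 1 for j < k. *)

theory Submission
  imports Defs "HOL-Real_Asymp.Real_Asymp"
begin

section \<open>Independent sets and common non-neighbours\<close>

lemma independent_sets_subset_Pow: "independent_sets n g \<subseteq> Pow {1..n}"
  by (auto simp: independent_sets_def)

lemma independent_set_subset: "S \<in> independent_sets n g \<Longrightarrow> S \<subseteq> {1..n}"
  by (auto simp: independent_sets_def)

lemma finite_independent_sets [simp]: "finite (independent_sets n g)"
  by (rule finite_subset[OF independent_sets_subset_Pow]) simp

lemma finite_independent_set: "S \<in> independent_sets n g \<Longrightarrow> finite S"
  by (auto simp: independent_sets_def intro: finite_subset)

lemma empty_independent_set [simp]: "{} \<in> independent_sets n g"
  by (auto simp: independent_sets_def)

lemma independent_sets_nonempty [simp]: "independent_sets n g \<noteq> {}"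
  using empty_independent_set by blast

lemma independent_sets_mono: "S \<in> independent_sets n g \<Longrightarrow> T \<subseteq> S \<Longrightarrow> T \<in> independent_sets n g"
  unfolding independent_sets_def by blast

lemma card_independent_sets_pos: "0 < card (independent_sets n g)"
  by (simp add: card_gt_0_iff)

section \<open>Growth of the number of independent sets with their size\<close>

definition extensions :: "nat \<Rightarrow> (nat set \<Rightarrow> bool) \<Rightarrow> nat set \<Rightarrow> nat set" where
  "extensions n g T = {v \<in> {1..n} - T. \<forall>u\<in>T. \<not> g {u, v}}"

text \<open>The threshold \<open>2 * k\<close> leaves a factor 2 after division by the at most
  \<open>k\<close> ways of deleting one vertex from a set of size at most \<open>k\<close>.
  Quantifying over all small \<open>T\<close>, independent or not, leaves an event to which a union
  bound applies.\<close>

definition extendable :: "nat \<Rightarrow> nat \<Rightarrow> (nat set \<Rightarrow> bool) \<Rightarrow> bool" where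
  "extendable k n g \<longleftrightarrow> (\<forall>T\<subseteq>{1..n}. card T < k \<longrightarrow> 2 * k \<le> card (extensions n g T))"

lemma insert_extension_independent:
  assumes "S \<in> independent_sets n g" "v \<in> extensions n g S"
  shows "insert v S \<in> independent_sets n g"
  using assms by (auto simp: independent_sets_def extensions_def insert_commute[of v])

text \<open>Double counting of pairs (S, v) with v an extension of S: each S of size
  \<open>j\<close> lies in at least \<open>2 * k\<close> pairs, while each independent set of size
  \<open>Suc j\<close> \<le> \<open>k\<close> arises from at most \<open>Suc j\<close> of them.
  Keeping v in the image \<open>(insert v S, v)\<close> makes the map injective, as v is outside
  S.\<close>

lemma card_independent_sets_Suc:
  assumes "extendable k n g" "j < k"
  shows "2 * card {S \<in> independent_sets n g. card S = j}
           \<le> card {S \<in> independent_sets n g. card S = Suc j}"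
proof -
  define A where "A j = {S \<in> independent_sets n g. card S = j}" for j
  have fin: "finite (A j)" for j by (simp add: A_def)
  have finS: "finite S" if "S \<in> A j" for S j
    using that finite_independent_set by (auto simp: A_def)
  have fine: "finite (extensions n g S)" for S by (simp add: extensions_def)
  have "card (A j) * (2 * k) = (\<Sum>S\<in>A j. 2 * k)" by simp
  also have "\<dots> \<le> (\<Sum>S\<in>A j. card (extensions n g S))"
    using assms independent_sets_subset_Pow[of n g]
    by (intro sum_mono) (auto simp: extendable_def A_def)
  also have "\<dots> = card (SIGMA S:A j. extensions n g S)"
    using fin fine by (subst card_SigmaI) auto
  also have "\<dots> \<le> card (SIGMA S:A (Suc j). S)"
  proof (rule card_inj_on_le[where f = "\<lambda>(S, v). (insert v S, v)"])
    show "inj_on (\<lambda>(S, v). (insert v S, v)) (SIGMA S:A j. extensions n g S)"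
    proof (rule inj_onI, clarsimp)
      fix S S' v assume "v \<in> extensions n g S" "v \<in> extensions n g S'" "insert v S = insert v S'"
      then show "S = S'" by (simp add: extensions_def insert_ident)
    qed
    show "(\<lambda>(S, v). (insert v S, v)) ` (SIGMA S:A j. extensions n g S) \<subseteq> (SIGMA S:A (Suc j). S)"
    proof clarsimp
      fix S v assume S: "S \<in> A j" and v: "v \<in> extensions n g S"
      then have "v \<notin> S" by (simp add: extensions_def)
      then show "insert v S \<in> A (Suc j)"
        using S v finS[OF S] by (simp add: A_def insert_extension_independent)
    qed
    show "finite (SIGMA S:A (Suc j). S)"
      using fin finS by (intro finite_SigmaI) auto
  qed
  also have "\<dots> = (\<Sum>S\<in>A (Suc j). card S)"
    using fin finS by (subst card_SigmaI) auto
  also have "\<dots> = card (A (Suc j)) * Suc j" by (simp add: A_def)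
  also have "\<dots> \<le> card (A (Suc j)) * k" using assms(2) by (intro mult_left_mono) auto
  finally show ?thesis using assms(2) by (simp add: A_def)
qed

text \<open>By the doubling, the sizes below \<open>k\<close> together contribute no more sets than
  size \<open>k\<close> alone. Hence at least half of all independent sets have size at least
  \<open>k\<close>, and the mean size is at least \<open>k / 2\<close>.\<close>

lemma sum_card_independent_sets_ge:
  assumes "extendable k n g"
  shows "k * card (independent_sets n g) \<le> 2 * (\<Sum>S\<in>independent_sets n g. card S)"
proof -
  define I where "I = independent_sets n g"
  define N where "N j = card {S \<in> I. card S = j}" for j
  have fin: "finite I" by (simp add: I_def)
  \<comment> \<open>Geometric growth: if the levels below m sum to at most \<open>N m\<close>,
    adding level m gives at most \<open>2 * N m\<close>, which is at most
    \<open>N (Suc m)\<close>.\<close>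
  have le: "(\<Sum>j<m. N j) \<le> N m" if "m \<le> k" for m
    using that
  proof (induction m)
    case (Suc m)
    then show ?case using card_independent_sets_Suc[OF assms, of m] by (simp add: N_def I_def)
  qed simp
  have "{S \<in> I. card S < k} = (\<Union>j<k. {S \<in> I. card S = j})" by auto
  then have "card {S \<in> I. card S < k} = (\<Sum>j<k. N j)"
    unfolding N_def using fin by (simp, subst card_UN_disjoint) auto
  also have "\<dots> \<le> N k" by (rule le) simp
  also have "\<dots> \<le> card {S \<in> I. k \<le> card S}"
    unfolding N_def using fin by (intro card_mono) auto
  finally have small: "card {S \<in> I. card S < k} \<le> card {S \<in> I. k \<le> card S}" .
  have "card I = card ({S \<in> I. card S < k} \<union> {S \<in> I. k \<le> card S})"
    by (rule arg_cong[of _ _ card]) auto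
  also have "\<dots> \<le> card {S \<in> I. card S < k} + card {S \<in> I. k \<le> card S}"
    by (rule card_Un_le)
  finally have "card I \<le> 2 * card {S \<in> I. k \<le> card S}"
    using small by linarith
  then have "k * card I \<le> 2 * (\<Sum>S\<in>{S \<in> I. k \<le> card S}. k)"
    using mult_le_mono2[of "card I" _ k] by (simp add: ac_simps)
  also have "\<dots> \<le> 2 * (\<Sum>S\<in>{S \<in> I. k \<le> card S}. card S)"
    by (intro mult_left_mono sum_mono) auto
  also have "\<dots> \<le> 2 * (\<Sum>S\<in>I. card S)"
    using fin by (intro mult_left_mono sum_mono2) auto
  finally show ?thesis by (simp add: I_def)
qed

section \<open>Couplings of hardcore models\<close>

definition indicator_vector :: "nat \<Rightarrow> nat set \<Rightarrow> nat \<Rightarrow> real" where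
  "indicator_vector n S = (\<lambda>i\<in>{1..n}. indicator S i)"

lemma indicator_vector_in_space: "indicator_vector n S \<in> space (euclidean_borel n)"
  by (auto simp: indicator_vector_def euclidean_borel_def space_PiM)

lemma hardcore_eq:
  "hardcore n g = distr (measure_pmf (pmf_of_set (independent_sets n g))) (euclidean_borel n)
     (indicator_vector n)"
  unfolding hardcore_def indicator_vector_def by simp

lemma sets_hardcore: "sets (hardcore n g) = sets (euclidean_borel n)"
  by (simp add: hardcore_eq)

lemma measurable_indicator_vector:
  "indicator_vector n \<in> measurable (measure_pmf p) (euclidean_borel n)"
  by (simp add: indicator_vector_in_space)

lemma integral_hardcore:
  fixes f :: "(nat \<Rightarrow> real) \<Rightarrow> real"
  assumes "f \<in> borel_measurable (euclidean_borel n)"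
  shows "(\<integral>x. f x \<partial>hardcore n g) =
    (\<Sum>S\<in>independent_sets n g. f (indicator_vector n S)) / card (independent_sets n g)"
  unfolding hardcore_eq
  by (subst integral_distr[OF measurable_indicator_vector assms])
    (simp add: integral_pmf_of_set)

text \<open>The support is a finite union of singletons, each measurable as a finite product of
  one-point sets. This measurability allows the almost-sure statement to be carried through
  \<open>distr\<close>.\<close>

lemma AE_hardcore: "AE x in hardcore n g. x \<in> indicator_vector n ` independent_sets n g"
proof -
  have single: "{x} \<in> sets (euclidean_borel n)" if "x \<in> space (euclidean_borel n)" for x
  proof -
    have "{x} = (\<Pi>\<^sub>E i\<in>{1..n}. {x i})"
      using that by (subst PiE_singleton) (auto simp: euclidean_borel_def space_PiM PiE_def)
    also have "\<dots> \<in> sets (euclidean_borel n)"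
      unfolding euclidean_borel_def by (intro sets_PiM_I_finite) auto
    finally show ?thesis .
  qed
  have "(\<Union>S\<in>independent_sets n g. {indicator_vector n S}) \<in> sets (euclidean_borel n)"
    by (intro sets.finite_UN finite_independent_sets single indicator_vector_in_space)
  also have "(\<Union>S\<in>independent_sets n g. {indicator_vector n S})
      = indicator_vector n ` independent_sets n g" by auto
  finally have meas: "indicator_vector n ` independent_sets n g \<in> sets (euclidean_borel n)" .
  then have "{x \<in> space (euclidean_borel n). x \<in> indicator_vector n ` independent_sets n g}
      \<in> sets (euclidean_borel n)"
    using sets.sets_into_space[OF meas] by (simp add: Int_absorb1 Int_def[symmetric] Collect_conj_eq)
  then show ?thesis
    unfolding hardcore_eq
    by (subst AE_distr_iff[OF measurable_indicator_vector]) (auto simp: AE_measure_pmf_iff)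
qed

lemma measurable_coordinate [measurable]:
  "i \<in> {1..n} \<Longrightarrow> (\<lambda>x. x i) \<in> borel_measurable (euclidean_borel n)"
  unfolding euclidean_borel_def by measurable

lemma L2_set_power2: "(L2_set x A)\<^sup>2 = (\<Sum>i\<in>A. (x i)\<^sup>2)"
  by (simp add: L2_set_def sum_nonneg)

lemma measurable_L2_set_power2:
  "(\<lambda>x. (L2_set x {1..n})\<^sup>2) \<in> borel_measurable (euclidean_borel n)"
  unfolding L2_set_power2 by (intro borel_measurable_sum borel_measurable_power measurable_coordinate)

definition inner_prod :: "nat \<Rightarrow> (nat \<Rightarrow> real) \<Rightarrow> (nat \<Rightarrow> real) \<Rightarrow> real" where
  "inner_prod n x y = (\<Sum>i=1..n. x i * y i)"

lemma inner_prod_indicator_vector: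
  "S \<subseteq> {1..n} \<Longrightarrow> inner_prod n (indicator_vector n S) (indicator_vector n S') = card (S \<inter> S')"
proof -
  assume S: "S \<subseteq> {1..n}"
  have "inner_prod n (indicator_vector n S) (indicator_vector n S')
      = (\<Sum>i=1..n. indicator (S \<inter> S') i)"
    unfolding inner_prod_def indicator_vector_def by (intro sum.cong) (auto simp: indicator_def)
  also have "\<dots> = card ({1..n} \<inter> (S \<inter> S'))" by (simp add: indicator_def Int_def)
  also have "{1..n} \<inter> (S \<inter> S') = S \<inter> S'" using S by auto
  finally show ?thesis .
qed

lemma L2_set_power2_indicator_vector:
  assumes "S \<subseteq> {1..n}"
  shows "(L2_set (indicator_vector n S) {1..n})\<^sup>2 = card S"
  unfolding L2_set_power2
  using inner_prod_indicator_vector[OF assms, of S] by (simp add: inner_prod_def power2_eq_square)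

lemma second_moment_hardcore:
  "second_moment n (hardcore n g) =
    (\<Sum>S\<in>independent_sets n g. real (card S)) / card (independent_sets n g)"
  unfolding second_moment_def integral_hardcore[OF measurable_L2_set_power2]
  by (simp add: L2_set_power2_indicator_vector independent_set_subset del: One_nat_def)

lemma second_moment_hardcore_pos:
  assumes "1 \<le> n"
  shows "0 < second_moment n (hardcore n g)"
proof -
  have "{1} \<in> independent_sets n g" using assms by (auto simp: independent_sets_def)
  then have "0 < (\<Sum>S\<in>independent_sets n g. real (card S))"
    by (intro sum_pos2[of _ "{1}"]) auto
  then show ?thesis
    unfolding second_moment_hardcore by (simp add: card_independent_sets_pos)
qed

lemma second_moment_hardcore_ge:
  assumes "extendable k n g"
  shows "k / 2 \<le> second_moment n (hardcore n g)"
proof -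
  have "real (k * card (independent_sets n g)) \<le> real (2 * (\<Sum>S\<in>independent_sets n g. card S))"
    using sum_card_independent_sets_ge[OF assms] by (simp only: of_nat_le_iff)
  then show ?thesis
    using card_independent_sets_pos[of n g]
    by (simp add: second_moment_hardcore field_simps)
qed

section \<open>Transport cost of a coupling\<close>

text \<open>The quantity under the square root in \<open>w2\<close>; the estimates are made at this
  level, before roots and the infimum are taken.\<close>

definition transport_cost ::
    "nat \<Rightarrow> (nat \<Rightarrow> real) measure \<Rightarrow> (nat \<Rightarrow> real) measure \<Rightarrow> ((nat \<Rightarrow> real) \<times> (nat \<Rightarrow> real)) measure \<Rightarrow> real" where
  "transport_cost n \<mu> \<nu> \<pi> = (\<integral>(x, y). (L2_set (\<lambda>i. x i / sqrt (second_moment n \<mu>) -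
                                     y i / sqrt (second_moment n \<nu>)) {1..n})\<^sup>2 \<partial>\<pi>)"

lemma w2_transport_cost: "w2 n \<mu> \<nu> = (INF \<pi>\<in>couplings \<mu> \<nu>. sqrt (transport_cost n \<mu> \<nu> \<pi>))"
  by (simp add: w2_def transport_cost_def)

lemma transport_cost_nonneg: "0 \<le> transport_cost n \<mu> \<nu> \<pi>"
  unfolding transport_cost_def by (rule integral_nonneg_AE) (auto simp: case_prod_beta)

text \<open>The independent coupling is a witness, built as the image of
  \<open>pair_pmf P P'\<close> so that its marginals reduce to those of a product of pmfs. Without
  it the infimum in \<open>w2\<close> could not be bounded below.\<close>

lemma couplings_hardcore_nonempty: "couplings (hardcore n g) (hardcore n g') \<noteq> {}"
proof -
  define P where "P = pmf_of_set (independent_sets n g)"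
  define P' where "P' = pmf_of_set (independent_sets n g')"
  define h where "h = map_prod (indicator_vector n) (indicator_vector n)"
  let ?N = "hardcore n g \<Otimes>\<^sub>M hardcore n g'"
  have space: "space (hardcore n g) = space (euclidean_borel n)" for g by (simp add: hardcore_eq)
  have h: "h \<in> measurable (measure_pmf (pair_pmf P P')) ?N"
    by (auto simp: h_def space_pair_measure space indicator_vector_in_space)
  have fst: "distr (distr (pair_pmf P P') ?N h) (hardcore n g) fst = hardcore n g"
  proof -
    have "distr (distr (pair_pmf P P') ?N h) (hardcore n g) fst
        = distr (pair_pmf P P') (hardcore n g) (indicator_vector n \<circ> fst)"
      by (subst distr_distr[OF _ h]) (auto simp: h_def o_def)
    also have "\<dots> = distr (map_pmf fst (pair_pmf P P')) (hardcore n g) (indicator_vector n)"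
      unfolding map_pmf_rep_eq by (subst distr_distr) (auto simp: space indicator_vector_in_space)
    also have "\<dots> = hardcore n g"
      unfolding map_fst_pair_pmf by (subst (2) hardcore_eq) (auto simp: P_def sets_hardcore intro!: distr_cong)
    finally show ?thesis .
  qed
  have snd: "distr (distr (pair_pmf P P') ?N h) (hardcore n g') snd = hardcore n g'"
  proof -
    have "distr (distr (pair_pmf P P') ?N h) (hardcore n g') snd
        = distr (pair_pmf P P') (hardcore n g') (indicator_vector n \<circ> snd)"
      by (subst distr_distr[OF _ h]) (auto simp: h_def o_def)
    also have "\<dots> = distr (map_pmf snd (pair_pmf P P')) (hardcore n g') (indicator_vector n)"
      unfolding map_pmf_rep_eq by (subst distr_distr) (auto simp: space indicator_vector_in_space)
    also have "\<dots> = hardcore n g'"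
      unfolding map_snd_pair_pmf by (subst (2) hardcore_eq) (auto simp: P'_def sets_hardcore intro!: distr_cong)
    finally show ?thesis .
  qed
  have "distr (pair_pmf P P') ?N h \<in> couplings (hardcore n g) (hardcore n g')"
    using fst snd measure_pmf.prob_space_distr[OF h] by (simp add: couplings_def)
  then show ?thesis by blast
qed

lemma measurable_inner_prod:
  "(\<lambda>z. inner_prod n (fst z) (snd z)) \<in> borel_measurable (euclidean_borel n \<Otimes>\<^sub>M euclidean_borel n)"
  unfolding inner_prod_def
  by (intro borel_measurable_sum borel_measurable_times
      measurable_compose[OF measurable_fst measurable_coordinate]
      measurable_compose[OF measurable_snd measurable_coordinate])

context
  fixes n :: nat and g g' :: "nat set \<Rightarrow> bool" and \<pi>
  assumes \<pi>: "\<pi> \<in> couplings (hardcore n g) (hardcore n g')"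
begin

interpretation \<pi>: prob_space \<pi> using \<pi> by (simp add: couplings_def)

lemma sets_coupling: "sets \<pi> = sets (euclidean_borel n \<Otimes>\<^sub>M euclidean_borel n)"
  using \<pi> by (simp add: couplings_def cong: sets_pair_measure_cong[OF sets_hardcore sets_hardcore])

lemma measurable_coupling_fst: "fst \<in> measurable \<pi> (euclidean_borel n)"
  by (simp add: measurable_cong_sets[OF sets_coupling refl])

lemma measurable_coupling_snd: "snd \<in> measurable \<pi> (euclidean_borel n)"
  by (simp add: measurable_cong_sets[OF sets_coupling refl])

lemma distr_coupling_fst: "distr \<pi> (euclidean_borel n) fst = hardcore n g"
proof -
  have "distr \<pi> (euclidean_borel n) fst = distr \<pi> (hardcore n g) fst"
    by (intro distr_cong) (simp_all add: sets_hardcore)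
  then show ?thesis using \<pi> by (simp add: couplings_def)
qed

lemma distr_coupling_snd: "distr \<pi> (euclidean_borel n) snd = hardcore n g'"
proof -
  have "distr \<pi> (euclidean_borel n) snd = distr \<pi> (hardcore n g') snd"
    by (intro distr_cong) (simp_all add: sets_hardcore)
  then show ?thesis using \<pi> by (simp add: couplings_def)
qed

text \<open>Both marginals are finitely supported, so any coupling lives on finitely many pairs of
  indicator vectors. Pointwise claims then become claims about pairs of independent sets.\<close>

lemma AE_coupling:
  "AE z in \<pi>. \<exists>S\<in>independent_sets n g. \<exists>S'\<in>independent_sets n g'.
     z = (indicator_vector n S, indicator_vector n S')"
proof -
  have "AE z in \<pi>. fst z \<in> indicator_vector n ` independent_sets n g"
    by (rule AE_distrD[OF measurable_coupling_fst]) (unfold distr_coupling_fst, rule AE_hardcore)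
  moreover have "AE z in \<pi>. snd z \<in> indicator_vector n ` independent_sets n g'"
    by (rule AE_distrD[OF measurable_coupling_snd]) (unfold distr_coupling_snd, rule AE_hardcore)
  ultimately show ?thesis
  proof eventually_elim
    case (elim z)
    then show ?case by (cases z) auto
  qed
qed

text \<open>On the finite support found in \<open>AE_coupling\<close> every function is bounded by
  its maximum \<open>B\<close>.\<close>

lemma integrable_coupling:
  fixes f :: "_ \<Rightarrow> real"
  assumes "f \<in> borel_measurable (euclidean_borel n \<Otimes>\<^sub>M euclidean_borel n)"
  shows "integrable \<pi> f"
proof -
  define B where "B = Max ((\<lambda>(S, S'). \<bar>f (indicator_vector n S, indicator_vector n S')\<bar>) `
    (independent_sets n g \<times> independent_sets n g'))"
  have "AE z in \<pi>. norm (f z) \<le> B"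
    using AE_coupling
  proof eventually_elim
    case (elim z)
    then show ?case unfolding B_def by (force intro!: Max_ge)
  qed
  then show ?thesis
    using assms by (intro \<pi>.integrable_const_bound) (auto simp: measurable_cong_sets[OF sets_coupling refl])
qed

lemma integral_coupling_fst:
  fixes f :: "_ \<Rightarrow> real"
  assumes "f \<in> borel_measurable (euclidean_borel n)"
  shows "(\<integral>z. f (fst z) \<partial>\<pi>) = (\<integral>x. f x \<partial>hardcore n g)"
  using integral_distr[OF measurable_coupling_fst assms] by (simp add: distr_coupling_fst)

lemma integral_coupling_snd:
  fixes f :: "_ \<Rightarrow> real"
  assumes "f \<in> borel_measurable (euclidean_borel n)"
  shows "(\<integral>z. f (snd z) \<partial>\<pi>) = (\<integral>x. f x \<partial>hardcore n g')"
  using integral_distr[OF measurable_coupling_snd assms] by (simp add: distr_coupling_snd)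

text \<open>Expanding the square, each normalized squared norm integrates to 1 and only the cross
  term depends on the coupling. Minimizing the cost is thus maximizing the expected overlap.\<close>

lemma transport_cost_coupling:
  assumes "1 \<le> n"
  shows "transport_cost n (hardcore n g) (hardcore n g') \<pi> =
    2 - 2 * (\<integral>z. inner_prod n (fst z) (snd z) \<partial>\<pi>) /
      sqrt (second_moment n (hardcore n g) * second_moment n (hardcore n g'))"
proof -
  define M where "M = second_moment n (hardcore n g)"
  define M' where "M' = second_moment n (hardcore n g')"
  have pos: "0 < M" "0 < M'"
    using second_moment_hardcore_pos[OF assms] by (auto simp: M_def M'_def)
  have expand: "(L2_set (\<lambda>i. x i / sqrt M - y i / sqrt M') {1..n})\<^sup>2
      = (L2_set x {1..n})\<^sup>2 / M + (L2_set y {1..n})\<^sup>2 / M' - 2 / sqrt (M * M') * inner_prod n x y" for x y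
    using pos unfolding L2_set_power2 inner_prod_def
    by (simp add: power2_diff power_divide real_sqrt_mult sum.distrib sum_subtractf
        sum_divide_distrib sum_distrib_left mult_ac)
  have int: "integrable \<pi> (\<lambda>z. (L2_set (fst z) {1..n})\<^sup>2 / M)"
    "integrable \<pi> (\<lambda>z. (L2_set (snd z) {1..n})\<^sup>2 / M')"
    "integrable \<pi> (\<lambda>z. 2 / sqrt (M * M') * inner_prod n (fst z) (snd z))"
    by (intro integrable_coupling borel_measurable_divide borel_measurable_times borel_measurable_const
       measurable_inner_prod measurable_compose[OF measurable_fst measurable_L2_set_power2]
       measurable_compose[OF measurable_snd measurable_L2_set_power2])+
  have "(\<integral>z. (L2_set (fst z) {1..n})\<^sup>2 / M \<partial>\<pi>) = 1"
    using integral_coupling_fst[OF measurable_L2_set_power2] pos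
    by (simp add: M_def second_moment_def)
  moreover have "(\<integral>z. (L2_set (snd z) {1..n})\<^sup>2 / M' \<partial>\<pi>) = 1"
    using integral_coupling_snd[OF measurable_L2_set_power2] pos
    by (simp add: M'_def second_moment_def)
  ultimately show ?thesis
    unfolding transport_cost_def M_def[symmetric] M'_def[symmetric] expand case_prod_beta
    using int by simp
qed

lemma integral_inner_prod_nonneg: "0 \<le> (\<integral>z. inner_prod n (fst z) (snd z) \<partial>\<pi>)"
proof (rule integral_nonneg_AE)
  show "AE z in \<pi>. 0 \<le> inner_prod n (fst z) (snd z)"
    using AE_coupling
  proof eventually_elim
    case (elim z)
    then show ?case
      by (auto simp: inner_prod_indicator_vector independent_set_subset simp del: One_nat_def)
  qed
qed

end

section \<open>Overlap bound uniform over all couplings\<close>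

text \<open>A first-moment bound for the probability that a uniform independent set S of
  \<open>g\<close> contains a \<open>t\<close>-set independent in \<open>g'\<close>. It depends on
  the two graphs only and not on a coupling.\<close>

definition mean_common_subsets :: "nat \<Rightarrow> nat \<Rightarrow> (nat set \<Rightarrow> bool) \<Rightarrow> (nat set \<Rightarrow> bool) \<Rightarrow> real" where
  "mean_common_subsets t n g g' =
     (\<Sum>S\<in>independent_sets n g. real (card {T \<in> independent_sets n g'. T \<subseteq> S \<and> card T = t}))
       / card (independent_sets n g)"

lemma prod_indicator_vector:
  assumes "T \<subseteq> {1..n}"
  shows "(\<Prod>i\<in>T. indicator_vector n S i) = of_bool (T \<subseteq> S)"
proof -
  have fin: "finite T" using assms finite_subset by blast
  have "(\<Prod>i\<in>T. indicator_vector n S i) = (\<Prod>i\<in>T. of_bool (i \<in> S))"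
    using assms by (intro prod.cong) (auto simp: indicator_vector_def indicator_def)
  also have "\<dots> = of_bool (T \<subseteq> S)" using fin by (induction T) auto
  finally show ?thesis .
qed

text \<open>If S and S' share more than \<open>t\<close> vertices, some \<open>t\<close>-subset of
  the intersection is independent in \<open>g'\<close>, so the number of such subsets of S is at
  least 1 and \<open>a\<close> times it exceeds or equals the overlap. That number is a function of
  S alone, hence its expectation is fixed by the first marginal.\<close>

lemma integral_inner_prod_le:
  assumes \<pi>: "\<pi> \<in> couplings (hardcore n g) (hardcore n g')"
    and a: "\<And>S. S \<in> independent_sets n g \<Longrightarrow> card S \<le> a"
  shows "(\<integral>z. inner_prod n (fst z) (snd z) \<partial>\<pi>) \<le> t + a * mean_common_subsets t n g g'"
proof -
  interpret \<pi>: prob_space \<pi> using \<pi> by (simp add: couplings_def)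
  define \<T> where "\<T> = {T \<in> independent_sets n g'. card T = t}"
  \<comment> \<open>A polynomial in the coordinates, hence Borel, whose value at the indicator
    vector of S is the number of members of \<open>\<T>\<close> contained in S.\<close>
  define f :: "(nat \<Rightarrow> real) \<Rightarrow> real" where "f = (\<lambda>x. \<Sum>T\<in>\<T>. \<Prod>i\<in>T. x i)"
  have fin: "finite \<T>" by (simp add: \<T>_def)
  have sub: "T \<subseteq> {1..n}" if "T \<in> \<T>" for T
    using that independent_set_subset by (auto simp: \<T>_def simp del: One_nat_def)
  have meas: "f \<in> borel_measurable (euclidean_borel n)"
    unfolding f_def using sub
    by (intro borel_measurable_sum borel_measurable_prod measurable_coordinate) blast
  have f: "f (indicator_vector n S) = card {T \<in> independent_sets n g'. T \<subseteq> S \<and> card T = t}" for S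
  proof -
    have "f (indicator_vector n S) = (\<Sum>T\<in>\<T>. of_bool (T \<subseteq> S))"
      unfolding f_def using sub by (intro sum.cong prod_indicator_vector) auto
    also have "\<dots> = card {T \<in> \<T>. T \<subseteq> S}"
      using fin by (simp add: of_bool_def sum.If_cases Int_def)
    also have "{T \<in> \<T>. T \<subseteq> S} = {T \<in> independent_sets n g'. T \<subseteq> S \<and> card T = t}"
      by (auto simp: \<T>_def)
    finally show ?thesis .
  qed
  have "AE z in \<pi>. inner_prod n (fst z) (snd z) \<le> t + a * f (fst z)"
    using AE_coupling[OF \<pi>]
  proof eventually_elim
    case (elim z)
    then obtain S S' where S: "S \<in> independent_sets n g" "S' \<in> independent_sets n g'"
      and z: "z = (indicator_vector n S, indicator_vector n S')" by blast
    have "S \<subseteq> {1..n}" using S(1) by (rule independent_set_subset)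
    then have inner: "inner_prod n (fst z) (snd z) = card (S \<inter> S')"
      by (simp add: z inner_prod_indicator_vector)
    show ?case
    proof (cases "card (S \<inter> S') \<le> t")
      case True
      then show ?thesis unfolding inner by (simp add: z f add_increasing2)
    next
      case False
      then obtain T where T: "T \<subseteq> S \<inter> S'" "card T = t"
        by (meson nat_le_linear obtain_subset_with_card_n)
      then have "T \<in> {T \<in> independent_sets n g'. T \<subseteq> S \<and> card T = t}"
        using S independent_sets_mono by auto
      then have "1 \<le> card {T \<in> independent_sets n g'. T \<subseteq> S \<and> card T = t}"
        by (simp add: Suc_le_eq card_gt_0_iff) blast
      then have "1 \<le> f (fst z)" by (simp add: z f)
      then have "real a * 1 \<le> a * f (fst z)" by (intro mult_left_mono) auto
      moreover have "card (S \<inter> S') \<le> a"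
        using a[OF S(1)] card_mono[OF finite_independent_set[OF S(1)], of "S \<inter> S'"] by simp
      ultimately show ?thesis unfolding inner by linarith
    qed
  qed
  moreover have int: "integrable \<pi> (\<lambda>z. inner_prod n (fst z) (snd z))"
      "integrable \<pi> (\<lambda>z. f (fst z))"
    by (intro integrable_coupling[OF \<pi>] measurable_inner_prod
        measurable_compose[OF measurable_fst meas])+
  ultimately have "(\<integral>z. inner_prod n (fst z) (snd z) \<partial>\<pi>) \<le> (\<integral>z. t + a * f (fst z) \<partial>\<pi>)"
    by (intro integral_mono_AE) auto
  also have "\<dots> = t + a * (\<integral>x. f x \<partial>hardcore n g)"
    using int integral_coupling_fst[OF \<pi> meas] by (simp add: \<pi>.prob_space)
  also have "(\<integral>x. f x \<partial>hardcore n g) = mean_common_subsets t n g g'"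
    by (simp add: integral_hardcore[OF meas] f mean_common_subsets_def)
  finally show ?thesis .
qed

section \<open>Bounds on the squared distance for a fixed pair of graphs\<close>

lemma w2_nonneg: "0 \<le> w2 n (hardcore n g) (hardcore n g')"
  unfolding w2_transport_cost
  by (intro cINF_greatest couplings_hardcore_nonempty real_sqrt_ge_zero transport_cost_nonneg)

lemma w2_power2_le:
  assumes "1 \<le> n"
  shows "(w2 n (hardcore n g) (hardcore n g'))\<^sup>2 \<le> 2"
proof -
  obtain \<pi> where \<pi>: "\<pi> \<in> couplings (hardcore n g) (hardcore n g')"
    using couplings_hardcore_nonempty by blast
  have "w2 n (hardcore n g) (hardcore n g') \<le> sqrt (transport_cost n (hardcore n g) (hardcore n g') \<pi>)"
    unfolding w2_transport_cost
    by (intro cINF_lower \<pi> bdd_belowI2[where m = 0] real_sqrt_ge_zero transport_cost_nonneg)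
  then have "(w2 n (hardcore n g) (hardcore n g'))\<^sup>2
      \<le> (sqrt (transport_cost n (hardcore n g) (hardcore n g') \<pi>))\<^sup>2"
    using w2_nonneg by (intro power_mono)
  also have "\<dots> = transport_cost n (hardcore n g) (hardcore n g') \<pi>"
    by (simp add: transport_cost_nonneg)
  also have "\<dots> \<le> 2"
    using integral_inner_prod_nonneg[OF \<pi>] second_moment_hardcore_pos[OF assms]
    by (simp add: transport_cost_coupling[OF \<pi> assms] less_imp_le)
  finally show ?thesis .
qed

text \<open>Extendability of both graphs gives \<open>sqrt (?M * ?M')\<close> \<ge>
  \<open>k / 2\<close>, which turns the factor 2 of the cross term into \<open>4 / k\<close>. The
  overlap bound holds for every coupling, so it passes to the infimum.\<close>

lemma w2_power2_ge:
  assumes n: "1 \<le> n" and k: "0 < k" and ext: "extendable k n g" "extendable k n g'"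
    and a: "\<And>S. S \<in> independent_sets n g \<Longrightarrow> card S \<le> a"
  shows "2 - 4 / k * (t + a * mean_common_subsets t n g g') \<le> (w2 n (hardcore n g) (hardcore n g'))\<^sup>2"
    (is "?B \<le> _")
\<comment> \<open>Squaring the bound on \<open>w2\<close> recovers \<open>?B\<close> from
  \<open>sqrt ?B\<close> only for nonnegative \<open>?B\<close>; otherwise the claim is
  trivial.\<close>
proof (cases "?B \<le> 0")
  case True
  then show ?thesis by (meson order_trans zero_le_power2)
next
  case False
  let ?M = "second_moment n (hardcore n g)" and ?M' = "second_moment n (hardcore n g')"
  have "(real k / 2)\<^sup>2 \<le> ?M * ?M'"
    unfolding power2_eq_square
    using second_moment_hardcore_ge[OF ext(1)] second_moment_hardcore_ge[OF ext(2)]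
    by (intro mult_mono) auto
  then have M: "k / 2 \<le> sqrt (?M * ?M')"
    by (rule real_le_rsqrt)
  have pos: "0 < ?M * ?M'"
    by (intro mult_pos_pos second_moment_hardcore_pos n)
  have cost: "?B \<le> transport_cost n (hardcore n g) (hardcore n g') \<pi>"
    if \<pi>: "\<pi> \<in> couplings (hardcore n g) (hardcore n g')" for \<pi>
  proof -
    let ?E = "\<integral>z. inner_prod n (fst z) (snd z) \<partial>\<pi>"
    have "2 * ?E / sqrt (?M * ?M') \<le> 2 * ?E / (k / 2)"
      using M k integral_inner_prod_nonneg[OF \<pi>] by (intro divide_left_mono mult_pos_pos) (auto simp: pos)
    also have "\<dots> = 4 / k * ?E" by simp
    also have "\<dots> \<le> 4 / k * (t + a * mean_common_subsets t n g g')"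
      by (intro mult_left_mono integral_inner_prod_le[OF \<pi> a]) auto
    finally show ?thesis unfolding transport_cost_coupling[OF \<pi> n] by simp
  qed
  have "sqrt ?B \<le> w2 n (hardcore n g) (hardcore n g')"
    unfolding w2_transport_cost
    by (intro cINF_greatest couplings_hardcore_nonempty real_sqrt_le_mono cost)
  then have "(sqrt ?B)\<^sup>2 \<le> (w2 n (hardcore n g) (hardcore n g'))\<^sup>2"
    using False by (intro power_mono) auto
  then show ?thesis using False by simp
qed

section \<open>Resampled random graphs\<close>

text \<open>Raising \<open>m\<close> by one adds a binomial coefficient of at most
  \<open>card A ^ m\<close>, and doubling \<open>card A ^ m\<close> stays below the next power
  because \<open>card A\<close> \<ge> 2.\<close>

lemma card_small_subsets_le:
  assumes "finite A" "2 \<le> card A"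
  shows "card {S. S \<subseteq> A \<and> card S < m} \<le> card A ^ m"
proof (induction m)
  case (Suc m)
  have "{S. S \<subseteq> A \<and> card S < Suc m} = {S. S \<subseteq> A \<and> card S < m} \<union> {S. S \<subseteq> A \<and> card S = m}"
    by auto
  then have "card {S. S \<subseteq> A \<and> card S < Suc m} \<le> card A ^ m + (card A choose m)"
    using Suc.IH card_Un_le[of "{S. S \<subseteq> A \<and> card S < m}" "{S. S \<subseteq> A \<and> card S = m}"]
      n_subsets[OF assms(1), of m] by simp
  also have "(card A choose m) \<le> card A ^ m"
    by (cases "m \<le> card A") (auto simp: binomial_le_pow binomial_eq_0)
  also have "card A ^ m + card A ^ m \<le> card A ^ Suc m"
    using assms(2) by (simp flip: mult_2)
  finally show ?case by simp
qed simp

lemma finite_vertex_pairs [simp]: "finite (vertex_pairs n)"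
  by (rule finite_subset[of _ "Pow {1..n}"]) (auto simp: vertex_pairs_def)

lemma prob_Pi_pmf_all_eq:
  assumes "finite A" "F \<subseteq> A"
  shows "measure_pmf.prob (Pi_pmf A d p) {f. \<forall>x\<in>F. f x = c} = (\<Prod>x\<in>F. pmf (p x) c)"
proof -
  have "{f. \<forall>x\<in>F. f x = c} = Pi A (\<lambda>x. if x \<in> F then {c} else UNIV)"
    using assms(2) by (auto simp: Pi_def split: if_splits)
  then have "measure_pmf.prob (Pi_pmf A d p) {f. \<forall>x\<in>F. f x = c}
      = (\<Prod>x\<in>A. if x \<in> F then pmf (p x) c else 1)"
    using assms(1) by (simp add: measure_Pi_pmf_Pi if_distrib measure_pmf_single cong: if_cong)
  also have "\<dots> = (\<Prod>x\<in>F. pmf (p x) c)"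
    using assms by (simp add: prod.If_cases Int_absorb1)
  finally show ?thesis .
qed

text \<open>Expresses independence through unordered pairs, the coordinates of the product law, so
  that it becomes a cylinder event.\<close>

lemma independent_set_iff_pairs:
  "T \<in> independent_sets n g \<longleftrightarrow> T \<subseteq> {1..n} \<and> (\<forall>e\<in>{e. e \<subseteq> T \<and> card e = 2}. g e = False)"
proof
  assume T: "T \<in> independent_sets n g"
  have "g e = False" if e: "e \<subseteq> T" "card e = 2" for e
  proof -
    obtain u v where "e = {u, v}" "u \<noteq> v" using e(2) by (auto simp: card_2_iff)
    then show ?thesis using T e(1) by (simp add: independent_sets_def)
  qed
  then show "T \<subseteq> {1..n} \<and> (\<forall>e\<in>{e. e \<subseteq> T \<and> card e = 2}. g e = False)"
    using independent_set_subset[OF T] by blast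
next
  assume T: "T \<subseteq> {1..n} \<and> (\<forall>e\<in>{e. e \<subseteq> T \<and> card e = 2}. g e = False)"
  have "\<not> g {u, v}" if "u \<in> T" "v \<in> T" "u \<noteq> v" for u v
    using T that by simp
  then show "T \<in> independent_sets n g" using T unfolding independent_sets_def by blast
qed

text \<open>An arbitrary product law covers both uses: the random graph with \<open>c = 1/2\<close>,
  and the resampling of a fixed graph in which \<open>T\<close> is independent, with
  \<open>c = 1 - s/2\<close>.\<close>

lemma prob_independent_set:
  assumes T: "T \<subseteq> {1..n}" and p: "\<And>e. e \<subseteq> T \<Longrightarrow> card e = 2 \<Longrightarrow> pmf (p e) False = c"
  shows "measure_pmf.prob (Pi_pmf (vertex_pairs n) False p) {g. T \<in> independent_sets n g}
    = c ^ (card T choose 2)"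
proof -
  have "{e. e \<subseteq> T \<and> card e = 2} \<subseteq> vertex_pairs n"
    using T by (auto simp: vertex_pairs_def)
  moreover have "{g. T \<in> independent_sets n g} = {g. \<forall>e\<in>{e. e \<subseteq> T \<and> card e = 2}. g e = False}"
    using T unfolding independent_set_iff_pairs by blast
  ultimately have "measure_pmf.prob (Pi_pmf (vertex_pairs n) False p) {g. T \<in> independent_sets n g}
    = (\<Prod>e\<in>{e. e \<subseteq> T \<and> card e = 2}. pmf (p e) False)"
    by (simp only: prob_Pi_pmf_all_eq[OF finite_vertex_pairs])
  also have "\<dots> = c ^ card {e. e \<subseteq> T \<and> card e = 2}" by (simp add: p)
  also have "card {e. e \<subseteq> T \<and> card e = 2} = card T choose 2"
    using T finite_subset by (intro n_subsets) auto
  finally show ?thesis .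
qed

lemma prob_independent_set_erdos_renyi:
  "T \<subseteq> {1..n} \<Longrightarrow>
    measure_pmf.prob (erdos_renyi_half n) {g. T \<in> independent_sets n g} = (1/2) ^ (card T choose 2)"
  unfolding erdos_renyi_half_def by (rule prob_independent_set) auto

lemma prob_independent_set_resample:
  assumes "T \<in> independent_sets n g" "0 < s" "s < 1"
  shows "measure_pmf.prob (resample n s g) {g'. T \<in> independent_sets n g'}
    = (1 - s/2) ^ (card T choose 2)"
  unfolding resample_def
proof (rule prob_independent_set)
  fix e assume "e \<subseteq> T" "card e = 2"
  then have "\<not> g e" using assms(1) by (auto simp: independent_set_iff_pairs)
  \<comment> \<open>A non-edge stays one if it is not resampled, or if it is and the fresh coin
    shows no edge: (1 - s) + s/2.\<close>
  then show "pmf (bernoulli_pmf s \<bind> (\<lambda>b. if b then bernoulli_pmf (1/2) else return_pmf (g e))) False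
      = 1 - s/2"
    using assms(2,3) by (simp add: pmf_bind)
qed (use assms independent_set_subset in auto)

section \<open>Finite support and marginals of the resampled pair\<close>

text \<open>Finite support makes every real function of the random graphs integrable, the squared
  distance included.\<close>

lemma finite_set_pmf_Pi_pmf_bool:
  fixes p :: "'a \<Rightarrow> bool pmf"
  assumes "finite A"
  shows "finite (set_pmf (Pi_pmf A d p))"
proof -
  have "finite (PiE_dflt A d (set_pmf \<circ> p))" using assms by (intro finite_PiE_dflt) auto
  then show ?thesis using set_Pi_pmf[OF assms] by metis
qed

lemma finite_set_pmf_erdos_renyi [simp]: "finite (set_pmf (erdos_renyi_half n))"
  unfolding erdos_renyi_half_def by (rule finite_set_pmf_Pi_pmf_bool) simp

lemma finite_set_pmf_resample [simp]: "finite (set_pmf (resample n s g))"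
  unfolding resample_def by (rule finite_set_pmf_Pi_pmf_bool) simp

lemma finite_set_pmf_resampled_pair [simp]: "finite (set_pmf (resampled_pair n s))"
  by (simp add: resampled_pair_def)

lemma map_fst_resampled_pair: "map_pmf fst (resampled_pair n s) = erdos_renyi_half n"
  by (simp add: resampled_pair_def map_bind_pmf map_pmf_comp bind_return_pmf')

text \<open>Stationarity, needed to control extendability of the second graph. On a single edge,
  drawing the resampling bit first leaves a fair coin in either branch; the edges are then combined
  by the product structure.\<close>

lemma map_snd_resampled_pair: "map_pmf snd (resampled_pair n s) = erdos_renyi_half n"
proof -
  have edge: "bind_pmf (bernoulli_pmf (1/2)) (\<lambda>x. bind_pmf (bernoulli_pmf s)
      (\<lambda>b. if b then bernoulli_pmf (1/2) else return_pmf x)) = bernoulli_pmf (1/2)"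
  proof -
    have "bind_pmf (bernoulli_pmf (1/2)) (\<lambda>x. if b then bernoulli_pmf (1/2) else return_pmf x)
        = bernoulli_pmf (1/2)" for b
      by (cases b) (auto simp: bind_return_pmf')
    then show ?thesis by (subst bind_commute_pmf) simp
  qed
  have "map_pmf snd (resampled_pair n s) = bind_pmf (erdos_renyi_half n) (resample n s)"
    by (simp add: resampled_pair_def map_bind_pmf map_pmf_comp)
  also have "\<dots> = erdos_renyi_half n"
    unfolding erdos_renyi_half_def resample_def
    by (subst Pi_pmf_bind[symmetric]) (simp_all add: edge)
  finally show ?thesis .
qed

section \<open>Typical properties of the random graph\<close>

text \<open>Any independent set larger than \<open>a\<close> contains an independent
  \<open>a\<close>-set; a union bound over the at most n^a such sets finishes.\<close>

lemma prob_large_independent_set: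
  "measure_pmf.prob (erdos_renyi_half n) {g. \<not> (\<forall>S\<in>independent_sets n g. card S \<le> a)}
     \<le> real n ^ a * (1/2) ^ (a choose 2)"
proof -
  define \<T> where "\<T> = {T. T \<subseteq> {1..n} \<and> card T = a}"
  have "{g. \<not> (\<forall>S\<in>independent_sets n g. card S \<le> a)} \<subseteq> (\<Union>T\<in>\<T>. {g. T \<in> independent_sets n g})"
  proof
    fix g assume "g \<in> {g. \<not> (\<forall>S\<in>independent_sets n g. card S \<le> a)}"
    then obtain S where S: "S \<in> independent_sets n g" "\<not> card S \<le> a" by blast
    then obtain T where T: "T \<subseteq> S" "card T = a"
      by (meson nat_le_linear obtain_subset_with_card_n)
    then have "T \<in> independent_sets n g" using S independent_sets_mono by blast
    then show "g \<in> (\<Union>T\<in>\<T>. {g. T \<in> independent_sets n g})"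
      using T independent_set_subset[of T n g] unfolding \<T>_def by blast
  qed
  then have "measure_pmf.prob (erdos_renyi_half n) {g. \<not> (\<forall>S\<in>independent_sets n g. card S \<le> a)}
      \<le> measure_pmf.prob (erdos_renyi_half n) (\<Union>T\<in>\<T>. {g. T \<in> independent_sets n g})"
    by (intro measure_pmf.finite_measure_mono) auto
  also have "\<dots> \<le> (\<Sum>T\<in>\<T>. measure_pmf.prob (erdos_renyi_half n) {g. T \<in> independent_sets n g})"
    by (intro measure_pmf.finite_measure_subadditive_finite) (auto simp: \<T>_def)
  also have "\<dots> = (\<Sum>T\<in>\<T>. (1/2) ^ (a choose 2))"
    by (intro sum.cong) (auto simp: \<T>_def prob_independent_set_erdos_renyi simp del: One_nat_def)
  also have "\<dots> = real (n choose a) * (1/2) ^ (a choose 2)"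
    by (simp add: \<T>_def n_subsets)
  also have "real (n choose a) \<le> real (n ^ a)"
    by (cases "a \<le> n") (auto simp: binomial_le_pow binomial_eq_0 simp del: of_nat_power)
  finally show ?thesis by (simp add: mult_right_mono)
qed

text \<open>Different vertices of \<open>W\<close> see disjoint sets of potential edges to
  \<open>T\<close>, so the events are independent. Each fails exactly when all \<open>card T\<close>
  edges are absent.\<close>

lemma prob_all_adjacent:
  assumes T: "T \<subseteq> {1..n}" and W: "W \<subseteq> {1..n} - T"
  shows "measure_pmf.prob (erdos_renyi_half n) {g. \<forall>v\<in>W. \<exists>u\<in>T. g {u, v}}
    = (1 - (1/2) ^ card T) ^ card W"
\<comment> \<open>The product formula for independent variables is applied to a nonempty index set;
  for empty \<open>W\<close> both sides are 1.\<close>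
proof (cases "W = {}")
  case False
  let ?M = "measure_pmf (erdos_renyi_half n)"
  note ps = measure_pmf.prob_space_axioms
  define K where "K v = (\<lambda>u. {u, v}) ` T" for v
  have fin: "finite T" "finite W" using T W finite_subset by blast+
  have K: "K v \<subseteq> vertex_pairs n" if "v \<in> W" for v
    using that T W by (fastforce simp: K_def vertex_pairs_def card_2_iff)
  have "prob_space.indep_vars (erdos_renyi_half n) (\<lambda>_. count_space UNIV) (\<lambda>e g. g e) (vertex_pairs n)"
    unfolding erdos_renyi_half_def by (rule indep_vars_Pi_pmf) simp
  then have "prob_space.indep_vars (erdos_renyi_half n) (\<lambda>v. PiM (K v) (\<lambda>_. count_space UNIV))
      (\<lambda>v g. restrict g (K v)) W"
  proof (rule prob_space.indep_vars_restrict[OF ps])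
    \<comment> \<open>As \<open>W\<close> avoids \<open>T\<close>, a pair with one end in
      \<open>T\<close> and the other in \<open>W\<close> determines its end in
      \<open>W\<close>.\<close>
    show "disjoint_family_on K W"
      using W by (auto simp: disjoint_family_on_def K_def doubleton_eq_iff)
  qed (rule K)
  then have "prob_space.indep_vars (erdos_renyi_half n) (\<lambda>v. count_space UNIV)
      (\<lambda>v g. \<exists>u\<in>T. restrict g (K v) {u, v}) W"
  proof (rule prob_space.indep_vars_compose2[OF ps])
    fix v
    have "(\<lambda>f. f {u, v}) \<in> measurable (PiM (K v) (\<lambda>_. count_space UNIV)) (count_space UNIV)"
      if "u \<in> T" for u
      using that by (intro measurable_component_singleton) (auto simp: K_def)
    then show "(\<lambda>f. \<exists>u\<in>T. f {u, v}) \<in> measurable (PiM (K v) (\<lambda>_. count_space UNIV)) (count_space UNIV)"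
      using fin by (intro pred_intros_finite) auto
  qed
  then have "measure_pmf.prob (erdos_renyi_half n) (\<Inter>v\<in>W. (\<lambda>g. \<exists>u\<in>T. restrict g (K v) {u, v}) -` {True} \<inter> space ?M)
     = (\<Prod>v\<in>W. measure_pmf.prob (erdos_renyi_half n) ((\<lambda>g. \<exists>u\<in>T. restrict g (K v) {u, v}) -` {True} \<inter> space ?M))"
    using False fin by (intro prob_space.indep_varsD[OF ps]) auto
  moreover have "(\<lambda>g. \<exists>u\<in>T. restrict g (K v) {u, v}) -` {True} \<inter> space ?M = {g. \<exists>u\<in>T. g {u, v}}" for v
    by (auto simp: K_def)
  ultimately have "measure_pmf.prob (erdos_renyi_half n) (\<Inter>v\<in>W. {g. \<exists>u\<in>T. g {u, v}})
     = (\<Prod>v\<in>W. measure_pmf.prob (erdos_renyi_half n) {g. \<exists>u\<in>T. g {u, v}})"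
    by simp
  also have "\<dots> = (\<Prod>v\<in>W. 1 - (1/2) ^ card T)"
  proof (intro prod.cong refl)
    fix v assume v: "v \<in> W"
    have "inj_on (\<lambda>u. {u, v}) T" by (rule inj_onI) (auto simp: doubleton_eq_iff)
    then have "card (K v) = card T" by (simp add: K_def card_image)
    then have "measure_pmf.prob (erdos_renyi_half n) {g. \<forall>e\<in>K v. g e = False} = (1/2) ^ card T"
      unfolding erdos_renyi_half_def using K[OF v] by (subst prob_Pi_pmf_all_eq) simp_all
    moreover have "{g. \<exists>u\<in>T. g {u, v}} = space ?M - {g. \<forall>e\<in>K v. g e = False}"
      by (auto simp: K_def)
    ultimately show "measure_pmf.prob (erdos_renyi_half n) {g. \<exists>u\<in>T. g {u, v}} = 1 - (1/2) ^ card T"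
      by (simp only:) (subst measure_pmf.prob_compl, auto)
  qed
  also have "(\<Inter>v\<in>W. {g. \<exists>u\<in>T. g {u, v}}) = {g. \<forall>v\<in>W. \<exists>u\<in>T. g {u, v}}" by auto
  finally show ?thesis by simp
qed simp

text \<open>If extendability fails at \<open>T\<close>, let \<open>U\<close> be its set of fewer
  than \<open>2 * k\<close> extensions: every vertex outside \<open>T\<close> and \<open>U\<close>
  has a neighbour in \<open>T\<close>. The union bound runs over at most n^k * n^(2k) pairs (T, U),
  and 1 - x \<le> exp (-x) bounds each event.\<close>

lemma prob_not_extendable:
  assumes n: "2 \<le> n"
  shows "measure_pmf.prob (erdos_renyi_half n) {g. \<not> extendable k n g}
    \<le> real n ^ (3 * k) * exp (- (real n - 3 * real k) / 2 ^ k)"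
proof -
  define \<A> where "\<A> m = {S. S \<subseteq> {1..n} \<and> card S < m}" for m
  have card\<A>: "card (\<A> m) \<le> n ^ m" for m
    using card_small_subsets_le[of "{1..n}" m] n by (simp add: \<A>_def)
  have fin: "finite (\<A> m)" for m by (simp add: \<A>_def)
  \<comment> \<open>\<open>U\<close> is fixed in advance here, so the event concerns a deterministic
    vertex set and \<open>prob_all_adjacent\<close> applies.\<close>
  define E where "E = (\<lambda>(T, U). {g :: nat set \<Rightarrow> bool. \<forall>v\<in>{1..n} - T - U. \<exists>u\<in>T. g {u, v}})"
  have "{g. \<not> extendable k n g} \<subseteq> (\<Union>z\<in>\<A> k \<times> \<A> (2 * k). E z)"
  proof clarify
    fix g assume "\<not> extendable k n g"
    then obtain T where T: "T \<subseteq> {1..n}" "card T < k" "card (extensions n g T) < 2 * k"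
      by (auto simp: extendable_def)
    then have "(T, extensions n g T) \<in> \<A> k \<times> \<A> (2 * k)" by (auto simp: \<A>_def extensions_def)
    moreover have "g \<in> E (T, extensions n g T)" by (auto simp: E_def extensions_def)
    ultimately show "g \<in> (\<Union>z\<in>\<A> k \<times> \<A> (2 * k). E z)" by blast
  qed
  then have "measure_pmf.prob (erdos_renyi_half n) {g. \<not> extendable k n g}
      \<le> measure_pmf.prob (erdos_renyi_half n) (\<Union>z\<in>\<A> k \<times> \<A> (2 * k). E z)"
    by (intro measure_pmf.finite_measure_mono) auto
  also have "\<dots> \<le> (\<Sum>z\<in>\<A> k \<times> \<A> (2 * k). measure_pmf.prob (erdos_renyi_half n) (E z))"
    using fin by (intro measure_pmf.finite_measure_subadditive_finite) auto
  also have "\<dots> \<le> (\<Sum>z\<in>\<A> k \<times> \<A> (2 * k). exp (- (real n - 3 * real k) / 2 ^ k))"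
  proof (rule sum_mono)
    fix z assume "z \<in> \<A> k \<times> \<A> (2 * k)"
    then obtain T U where z: "z = (T, U)" and T: "T \<subseteq> {1..n}" "card T < k"
      and U: "U \<subseteq> {1..n}" "card U < 2 * k"
      by (auto simp: \<A>_def)
    define W where "W = {1..n} - T - U"
    have finTU: "finite T" "finite U" using T U finite_subset by blast+
    have "card ({1..n} - (T \<union> U)) = n - card (T \<union> U)"
      using T U finTU by (subst card_Diff_subset) auto
    \<comment> \<open>\<open>T\<close> and \<open>U\<close> together have fewer than
      \<open>3 * k\<close> vertices. The difference is taken in the reals, so it may be negative for
      small \<open>n\<close>.\<close>
    then have W: "real n - 3 * real k \<le> card W"
      using card_Un_le[of T U] T U by (simp add: W_def Diff_eq Int_assoc)
    have "measure_pmf.prob (erdos_renyi_half n) (E z) = (1 - (1/2) ^ card T) ^ card W"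
      unfolding z E_def W_def prod.case using T by (intro prob_all_adjacent) auto
    also have "\<dots> \<le> (1 - (1/2) ^ k) ^ card W"
      using T by (intro power_mono diff_left_mono power_decreasing) (auto simp: power_le_one)
    also have "\<dots> \<le> exp (- ((1/2) ^ k)) ^ card W"
      using exp_ge_add_one_self[of "- ((1/2) ^ k)"] by (intro power_mono) (auto simp: power_le_one)
    also have "\<dots> = exp (- real (card W) / 2 ^ k)"
      by (simp add: exp_of_nat_mult[symmetric] power_divide)
    also have "\<dots> \<le> exp (- (real n - 3 * real k) / 2 ^ k)"
      unfolding exp_le_cancel_iff using W by (intro divide_right_mono) auto
    finally show "measure_pmf.prob (erdos_renyi_half n) (E z) \<le> exp (- (real n - 3 * real k) / 2 ^ k)" .
  qed
  also have "\<dots> = real (card (\<A> k) * card (\<A> (2 * k))) * exp (- (real n - 3 * real k) / 2 ^ k)"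
    by (simp add: card_cartesian_product)
  also have "real (card (\<A> k) * card (\<A> (2 * k))) \<le> real (n ^ k * n ^ (2 * k))"
    using card\<A> by (intro of_nat_mono mult_le_mono)
  also have "n ^ k * n ^ (2 * k) = n ^ (3 * k)" by (simp flip: power_add)
  finally show ?thesis by (simp add: mult_right_mono)
qed

section \<open>Expected overlap and expected squared distance\<close>

text \<open>Linearity over the \<open>t\<close>-subsets of \<open>S\<close>: each is independent in
  \<open>g\<close> by heredity, so it survives the resampling with the same probability.\<close>

lemma expectation_common_subsets:
  assumes S: "S \<in> independent_sets n g" and s: "0 < s" "s < 1"
  shows "measure_pmf.expectation (resample n s g)
      (\<lambda>g'. real (card {T \<in> independent_sets n g'. T \<subseteq> S \<and> card T = t}))
    = real (card S choose t) * (1 - s/2) ^ (t choose 2)"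
proof -
  define \<T> where "\<T> = {T. T \<subseteq> S \<and> card T = t}"
  have fin: "finite S" "finite \<T>" using finite_independent_set[OF S] by (auto simp: \<T>_def)
  have card: "real (card {T \<in> independent_sets n g'. T \<subseteq> S \<and> card T = t})
      = (\<Sum>T\<in>\<T>. indicator {g'. T \<in> independent_sets n g'} g')" for g'
  proof -
    have "{T \<in> independent_sets n g'. T \<subseteq> S \<and> card T = t} = \<T> \<inter> {T. T \<in> independent_sets n g'}"
      by (auto simp: \<T>_def)
    then show ?thesis using fin by (simp add: indicator_def)
  qed
  have "measure_pmf.expectation (resample n s g)
      (\<lambda>g'. real (card {T \<in> independent_sets n g'. T \<subseteq> S \<and> card T = t}))
    = (\<Sum>T\<in>\<T>. measure_pmf.prob (resample n s g) {g'. T \<in> independent_sets n g'})"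
    unfolding card by (subst Bochner_Integration.integral_sum)
      (auto intro: integrable_measure_pmf_finite)
  also have "\<dots> = (\<Sum>T\<in>\<T>. (1 - s/2) ^ (t choose 2))"
    using prob_independent_set_resample[OF independent_sets_mono[OF S] s]
    by (intro sum.cong) (auto simp: \<T>_def)
  finally show ?thesis using fin by (simp add: \<T>_def n_subsets)
qed

text \<open>Conditionally on \<open>g\<close>, a set S with at most \<open>a\<close> elements has at
  most \<open>2 ^ a\<close> subsets of size \<open>t\<close>. The indicator discards the graphs with
  larger independent sets, where this fails.\<close>

lemma expectation_mean_common_subsets_le:
  assumes s: "0 < s" "s < 1"
  shows "measure_pmf.expectation (resampled_pair n s)
      (\<lambda>(g, g'). of_bool (\<forall>S\<in>independent_sets n g. card S \<le> a) * mean_common_subsets t n g g')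
    \<le> 2 ^ a * (1 - s/2) ^ (t choose 2)"
    (is "measure_pmf.expectation _ ?h \<le> ?B")
proof -
  have inner: "measure_pmf.expectation (resample n s g) (\<lambda>g'. ?h (g, g')) \<le> ?B" for g
  proof (cases "\<forall>S\<in>independent_sets n g. card S \<le> a")
    case True
    let ?I = "independent_sets n g"
    have "measure_pmf.expectation (resample n s g) (\<lambda>g'. ?h (g, g'))
        = (\<Sum>S\<in>?I. real (card S choose t) * (1 - s/2) ^ (t choose 2)) / card ?I"
      using True s
      by (simp add: mean_common_subsets_def expectation_common_subsets
          Bochner_Integration.integral_sum integrable_measure_pmf_finite)
    also have "\<dots> \<le> (\<Sum>S\<in>?I. ?B) / card ?I"
    proof (intro divide_right_mono sum_mono mult_right_mono)
      fix S assume "S \<in> ?I"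
      then have "card S choose t \<le> 2 ^ a"
        using True binomial_le_pow2[of "card S" t] power_increasing[of "card S" a "2::nat"]
        by (auto intro: order_trans)
      then have "real (card S choose t) \<le> real (2 ^ a)" by (simp only: of_nat_le_iff)
      then show "real (card S choose t) \<le> 2 ^ a" by simp
    qed (use s in auto)
    also have "\<dots> = ?B" using card_independent_sets_pos[of n g] by simp
    finally show ?thesis .
  next
    case False
    then have "(\<lambda>g'. ?h (g, g')) = (\<lambda>_. 0)" by (auto simp: fun_eq_iff)
    then show ?thesis using s by simp
  qed
  have "measure_pmf.expectation (resampled_pair n s) ?h
      = (\<Sum>g\<in>set_pmf (erdos_renyi_half n). pmf (erdos_renyi_half n) g *
          measure_pmf.expectation (resample n s g) (\<lambda>g'. ?h (g, g')))"
    unfolding resampled_pair_def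
    by (subst pmf_expectation_bind[of "set_pmf (erdos_renyi_half n)"]) auto
  also have "\<dots> \<le> (\<Sum>g\<in>set_pmf (erdos_renyi_half n). pmf (erdos_renyi_half n) g * ?B)"
    by (intro sum_mono mult_left_mono inner) auto
  also have "\<dots> = ?B"
    by (simp add: sum_distrib_right[symmetric] sum_pmf_eq_1)
  finally show ?thesis .
qed

lemma expectation_w2_power2_le:
  assumes "1 \<le> n"
  shows "measure_pmf.expectation (resampled_pair n s)
    (\<lambda>(g, g'). (w2 n (hardcore n g) (hardcore n g'))\<^sup>2) \<le> 2"
proof -
  have "measure_pmf.expectation (resampled_pair n s)
      (\<lambda>(g, g'). (w2 n (hardcore n g) (hardcore n g'))\<^sup>2)
    \<le> measure_pmf.expectation (resampled_pair n s) (\<lambda>_. 2)"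
    using w2_power2_le[OF assms]
    by (intro integral_mono integrable_measure_pmf_finite) auto
  then show ?thesis by simp
qed

text \<open>The factor 4 collects the failure of extendability in \<open>g\<close> and in
  \<open>g'\<close>, which have the same law; the factor 2 before the next term pays for a large
  independent set in \<open>g\<close>.\<close>

lemma expectation_w2_power2_ge:
  assumes n: "2 \<le> n" and k: "0 < k" and s: "0 < s" "s < 1"
  shows "2 - 4 * (real n ^ (3 * k) * exp (- (real n - 3 * real k) / 2 ^ k))
      - 2 * (real n ^ a * (1/2) ^ (a choose 2))
      - 4 / k * (t + a * (2 ^ a * (1 - s/2) ^ (t choose 2)))
    \<le> measure_pmf.expectation (resampled_pair n s)
        (\<lambda>(g, g'). (w2 n (hardcore n g) (hardcore n g'))\<^sup>2)"
proof -
  let ?p = "resampled_pair n s"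
  define A where "A = {g. \<not> extendable k n g}"
  define B where "B = {g. \<not> (\<forall>S\<in>independent_sets n g. card S \<le> a)}"
  define h where "h = (\<lambda>(g, g'). of_bool (\<forall>S\<in>independent_sets n g. card S \<le> a) * mean_common_subsets t n g g')"
  \<comment> \<open>A pointwise lower bound for the squared distance: each bad event costs 2, which
    pushes \<open>H\<close> to at most 0, and off the bad events \<open>w2_power2_ge\<close>
    applies.\<close>
  define H where "H z = 2 - 2 * indicator A (fst z) - 2 * indicator A (snd z) - 2 * indicator B (fst z)
     - 4 / k * (t + a * h z)" for z
  have int: "integrable ?p f" for f :: "_ \<Rightarrow> real"
    by (rule integrable_measure_pmf_finite) simp
  have "measure_pmf.expectation ?p (\<lambda>z. indicat_real A (fst z))
      = measure_pmf.expectation (map_pmf fst ?p) (indicator A)"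
    by (rule integral_map_pmf[symmetric])
  also have "\<dots> \<le> real n ^ (3 * k) * exp (- (real n - 3 * real k) / 2 ^ k)"
    unfolding map_fst_resampled_pair A_def using prob_not_extendable[OF n] by simp
  finally have A1: "measure_pmf.expectation ?p (\<lambda>z. indicat_real A (fst z))
      \<le> real n ^ (3 * k) * exp (- (real n - 3 * real k) / 2 ^ k)" .
  have "measure_pmf.expectation ?p (\<lambda>z. indicat_real A (snd z))
      = measure_pmf.expectation (map_pmf snd ?p) (indicator A)"
    by (rule integral_map_pmf[symmetric])
  also have "\<dots> \<le> real n ^ (3 * k) * exp (- (real n - 3 * real k) / 2 ^ k)"
    unfolding map_snd_resampled_pair A_def using prob_not_extendable[OF n] by simp
  finally have A2: "measure_pmf.expectation ?p (\<lambda>z. indicat_real A (snd z))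
      \<le> real n ^ (3 * k) * exp (- (real n - 3 * real k) / 2 ^ k)" .
  have "measure_pmf.expectation ?p (\<lambda>z. indicat_real B (fst z))
      = measure_pmf.expectation (map_pmf fst ?p) (indicator B)"
    by (rule integral_map_pmf[symmetric])
  also have "\<dots> \<le> real n ^ a * (1/2) ^ (a choose 2)"
    unfolding map_fst_resampled_pair B_def using prob_large_independent_set by simp
  finally have B1: "measure_pmf.expectation ?p (\<lambda>z. indicat_real B (fst z)) \<le> real n ^ a * (1/2) ^ (a choose 2)" .
  have h: "4 / k * (t + a * measure_pmf.expectation ?p h)
      \<le> 4 / k * (t + a * (2 ^ a * (1 - s/2) ^ (t choose 2)))"
    unfolding h_def
    by (intro mult_left_mono add_left_mono expectation_mean_common_subsets_le s) auto
  have "measure_pmf.expectation ?p H = 2 - 2 * measure_pmf.expectation ?p (\<lambda>z. indicat_real A (fst z))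
      - 2 * measure_pmf.expectation ?p (\<lambda>z. indicat_real A (snd z))
      - 2 * measure_pmf.expectation ?p (\<lambda>z. indicat_real B (fst z))
      - 4 / k * (t + a * measure_pmf.expectation ?p h)"
    unfolding H_def by (simp add: int del: integral_indicator)
  moreover have "measure_pmf.expectation ?p H \<le> measure_pmf.expectation ?p
      (\<lambda>(g, g'). (w2 n (hardcore n g) (hardcore n g'))\<^sup>2)"
  proof (intro integral_mono int)
    fix z :: "(nat set \<Rightarrow> bool) \<times> (nat set \<Rightarrow> bool)"
    obtain g g' where z: "z = (g, g')" by (cases z)
    have "0 \<le> h z" by (auto simp: z h_def mean_common_subsets_def sum_nonneg)
    then have rest: "0 \<le> 4 / k * (t + a * h z)" by simp
    have "H z \<le> (w2 n (hardcore n g) (hardcore n g'))\<^sup>2"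
    proof (cases "g \<in> A \<or> g' \<in> A \<or> g \<in> B")
      case True
      then have "H z \<le> 0" using rest by (auto simp: H_def z indicator_def)
      then show ?thesis by (meson order_trans zero_le_power2)
    next
      case False
      then have "H z = 2 - 4 / k * (t + a * mean_common_subsets t n g g')"
        by (auto simp: H_def z h_def B_def)
      then show ?thesis
        using False n k w2_power2_ge[of n k g g' a t] by (auto simp: A_def B_def)
    qed
    then show "H z \<le> (case z of (g, g') \<Rightarrow> (w2 n (hardcore n g) (hardcore n g'))\<^sup>2)" by (simp add: z)
  qed
  ultimately show ?thesis using A1 A2 B1 h by linarith
qed

section \<open>Asymptotics\<close>

lemma real_choose_two: "real (m choose 2) = real m * (real m - 1) / 2"
proof (induction m)
  case (Suc m)
  have "Suc m choose 2 = m + (m choose 2)" by (simp add: numeral_2_eq_2)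
  then show ?case using Suc.IH by (simp add: field_simps)
qed simp

lemma filterlim_log2_at_top: "filterlim (\<lambda>n. log 2 (real n)) at_top sequentially"
  by real_asymp

text \<open>Here \<open>2 ^ k n\<close> is at most n^(1/4), so the exponential is about exp
  (-n^(3/4)), which beats the factor n^(3 k), of size exp (O((log n)^2)).\<close>

lemma tendsto_prob_not_extendable:
  fixes k :: "nat \<Rightarrow> nat"
  assumes k: "\<And>n. 1 \<le> n \<Longrightarrow> real (k n) \<le> log 2 (real n) / 4"
  shows "(\<lambda>n. real n ^ (3 * k n) * exp (- (real n - 3 * real (k n)) / 2 ^ k n)) \<longlonglongrightarrow> 0"
proof (rule tendsto_sandwich[OF _ _ tendsto_const])
  let ?u = "\<lambda>n. real n powr (3 * (log 2 (real n) / 4)) *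
    exp (- (real n - 3 * (log 2 (real n) / 4)) / real n powr (1/4))"
  show "?u \<longlonglongrightarrow> 0" by real_asymp
  \<comment> \<open>Keeps \<open>real n - 3 * real (k n)\<close> nonnegative, so that enlarging the
    denominator decreases the quotient.\<close>
  have "\<forall>\<^sub>F n in sequentially. 3 * (log 2 (real n) / 4) \<le> real n" by real_asymp
  then show "\<forall>\<^sub>F n in sequentially.
      real n ^ (3 * k n) * exp (- (real n - 3 * real (k n)) / 2 ^ k n) \<le> ?u n"
    using eventually_ge_at_top[of 1]
  proof eventually_elim
    case (elim n)
    have "real n ^ (3 * k n) = real n powr (3 * real (k n))"
      using elim by (simp flip: powr_realpow)
    also have "\<dots> \<le> real n powr (3 * (log 2 (real n) / 4))"
      using elim k[of n] by (intro powr_mono) auto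
    finally have 1: "real n ^ (3 * k n) \<le> real n powr (3 * (log 2 (real n) / 4))" .
    have "2 ^ k n = 2 powr real (k n)" by (simp add: powr_realpow)
    also have "\<dots> \<le> 2 powr (log 2 (real n) * (1/4))"
      using elim k[of n] by (intro powr_mono) auto
    also have "\<dots> = real n powr (1/4)"
      using elim by (subst powr_powr[symmetric]) simp
    finally have 2: "2 ^ k n \<le> real n powr (1/4)" .
    have "(real n - 3 * (log 2 (real n) / 4)) / real n powr (1/4)
        \<le> (real n - 3 * real (k n)) / 2 ^ k n"
      using elim k[of n] 2 by (intro frac_le) auto
    then have "exp (- (real n - 3 * real (k n)) / 2 ^ k n)
        \<le> exp (- (real n - 3 * (log 2 (real n) / 4)) / real n powr (1/4))"
      by (simp only: exp_le_cancel_iff minus_divide_left[symmetric] neg_le_iff_le)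
    then show ?case
      using 1 by (intro mult_mono) auto
  qed
qed auto

text \<open>With L = log2 n the bound is 2 to the power -a ((a - 1)/2 - L). For a \<ge> 4 L the
  bracket is at least L - 1/2, so the exponent is at most -4 L (L - 1/2).\<close>

lemma tendsto_prob_large_independent_set:
  fixes a :: "nat \<Rightarrow> nat"
  assumes a: "\<And>n. 1 \<le> n \<Longrightarrow> 4 * log 2 (real n) \<le> a n"
  shows "(\<lambda>n. real n ^ a n * (1/2) ^ (a n choose 2)) \<longlonglongrightarrow> 0"
proof (rule tendsto_sandwich[OF _ _ tendsto_const])
  have "((\<lambda>L::real. 2 powr (4 * L * (1/2 - L))) \<longlongrightarrow> 0) at_top" by real_asymp
  then show "(\<lambda>n. 2 powr (4 * log 2 (real n) * (1/2 - log 2 (real n)))) \<longlonglongrightarrow> 0"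
    by (rule filterlim_compose[OF _ filterlim_log2_at_top])
  have "\<forall>\<^sub>F n in sequentially. 1 \<le> log 2 (real n)" by real_asymp
  then show "\<forall>\<^sub>F n in sequentially. real n ^ a n * (1/2) ^ (a n choose 2)
      \<le> 2 powr (4 * log 2 (real n) * (1/2 - log 2 (real n)))"
    using eventually_ge_at_top[of 1]
  proof eventually_elim
    case (elim n)
    define L where "L = log 2 (real n)"
    have L: "1 \<le> L" "4 * L \<le> a n" using elim a[of n] by (auto simp: L_def)
    have "real n = 2 powr L" using elim by (simp add: L_def)
    then have "real n ^ a n = 2 powr (L * a n)"
      by (simp add: powr_powr[symmetric] powr_realpow)
    moreover have "(1/2::real) ^ (a n choose 2) = 2 powr (- real (a n choose 2))"
      by (simp add: powr_minus powr_realpow power_divide field_simps)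
    ultimately have "real n ^ a n * (1/2) ^ (a n choose 2) = 2 powr (L * a n - a n * (real (a n) - 1) / 2)"
      by (simp add: powr_add[symmetric] real_choose_two)
    also have "L * a n - a n * (real (a n) - 1) / 2 = - (a n * ((real (a n) - 1) / 2 - L))"
      by (simp add: field_simps)
    also have "\<dots> \<le> - (4 * L * (L - 1/2))"
      using L by (intro le_imp_neg_le mult_mono) auto
    also have "- (4 * L * (L - 1/2)) = 4 * L * (1/2 - L)" by (simp add: algebra_simps)
    finally show ?case by (simp add: L_def)
  qed
qed auto

text \<open>With L = log2 n: \<open>2 ^ a n\<close> is exp (O(L)), while the power of
  \<open>q\<close> decays like exp (-const * L^(3/2)) and wins; the remaining t / k is of order
  L^(-1/4). The exponent 3/4 is used because it lies strictly between 1/2, which the first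
  comparison requires, and 1, which the second does.\<close>

lemma tendsto_mean_overlap:
  fixes k t a :: "nat \<Rightarrow> nat" and q :: real
  assumes q: "0 < q" "q < 1"
    and k: "\<And>n. 1 \<le> n \<Longrightarrow> log 2 (real n) / 4 - 1 \<le> k n"
    and a: "\<And>n. 1 \<le> n \<Longrightarrow> a n \<le> 4 * log 2 (real n) + 1"
    and t: "\<And>n. 1 \<le> n \<Longrightarrow> log 2 (real n) powr (3/4) \<le> t n"
      "\<And>n. 1 \<le> n \<Longrightarrow> t n \<le> log 2 (real n) powr (3/4) + 1"
  shows "(\<lambda>n. 4 / k n * (t n + a n * (2 ^ a n * q ^ (t n choose 2)))) \<longlonglongrightarrow> 0"
proof (rule tendsto_sandwich[OF _ _ tendsto_const])
  define b where "b = ln (2::real)"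
  define c where "c = - ln q"
  have bc: "0 < b" "0 < c" using q by (auto simp: b_def c_def)
  let ?u = "\<lambda>L::real. 4 / (L / 4 - 1) * (L powr (3/4) + 1 + (4 * L + 1) *
    (exp (b * (4 * L + 1)) * exp (- (c * (L powr (3/4) * (L powr (3/4) - 1) / 2)))))"
  have "(?u \<longlongrightarrow> 0) at_top" using bc by real_asymp
  then show "(\<lambda>n. ?u (log 2 (real n))) \<longlonglongrightarrow> 0"
    by (rule filterlim_compose[OF _ filterlim_log2_at_top])
  \<comment> \<open>Makes the denominator L/4 - 1 positive and L^(3/4) at least 1, as the
    monotonicity estimates require.\<close>
  have "\<forall>\<^sub>F n in sequentially. 5 \<le> log 2 (real n)" by real_asymp
  then show "\<forall>\<^sub>F n in sequentially. 4 / k n * (t n + a n * (2 ^ a n * q ^ (t n choose 2)))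
      \<le> ?u (log 2 (real n))"
    using eventually_ge_at_top[of 1]
  proof eventually_elim
    case (elim n)
    define L where "L = log 2 (real n)"
    have L: "5 \<le> L" using elim by (simp add: L_def)
    define u where "u = L powr (3/4)"
    have "1 \<le> u" unfolding u_def using L by (intro ge_one_powr_ge_zero) auto
    then have u: "1 \<le> u" "u \<le> t n" "t n \<le> u + 1"
      using t[of n] elim by (auto simp: L_def u_def)
    have kL: "L / 4 - 1 \<le> k n" and aL: "a n \<le> 4 * L + 1" using k a elim by (auto simp: L_def)
    have "(2::real) ^ a n = exp (b * a n)" by (simp add: b_def exp_of_nat2_mult)
    also have "\<dots> \<le> exp (b * (4 * L + 1))" using aL bc by simp
    finally have 1: "2 ^ a n \<le> exp (b * (4 * L + 1))" .
    have "q ^ (t n choose 2) = exp (ln q * real (t n choose 2))"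
      using q by (simp add: exp_of_nat2_mult)
    also have "\<dots> = exp (- (c * (t n * (real (t n) - 1) / 2)))"
      by (simp add: real_choose_two c_def)
    also have "\<dots> \<le> exp (- (c * (u * (u - 1) / 2)))"
      using u bc by (auto intro!: mult_mono)
    finally have 2: "q ^ (t n choose 2) \<le> exp (- (c * (u * (u - 1) / 2)))" .
    show ?case
      unfolding L_def[symmetric] u_def[symmetric]
      using kL aL L u 1 2 q
      by (intro mult_mono add_mono frac_le) auto
  qed
qed (use q in auto)

section \<open>The limit for fixed s\<close>

lemma tendsto_expectation_w2_power2:
  assumes s: "0 < s" "s < 1"
  shows "(\<lambda>n. measure_pmf.expectation (resampled_pair n s)
    (\<lambda>(g, g'). (w2 n (hardcore n g) (hardcore n g'))\<^sup>2)) \<longlonglongrightarrow> 2"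
proof (rule tendsto_sandwich[OF _ _ _ tendsto_const])
  \<comment> \<open>\<open>k\<close> is chosen so that \<open>2 ^ k n\<close> \<le> n^(1/4),
    \<open>a\<close> at about twice the typical largest size 2 log2 n of an independent set, and
    \<open>t\<close> between the square root of log n and log n.\<close>
  define k where "k n = nat \<lfloor>log 2 (real n) / 4\<rfloor>" for n
  define a where "a n = nat \<lceil>4 * log 2 (real n)\<rceil>" for n
  define t where "t n = nat \<lceil>log 2 (real n) powr (3/4)\<rceil>" for n
  have log: "0 \<le> log 2 (real n)" if "1 \<le> n" for n using that by simp
  have k: "real (k n) \<le> log 2 (real n) / 4" "log 2 (real n) / 4 - 1 \<le> k n" if "1 \<le> n" for n
    using log[OF that] unfolding k_def by linarith+
  have a: "4 * log 2 (real n) \<le> a n" "a n \<le> 4 * log 2 (real n) + 1" if "1 \<le> n" for n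
    using log[OF that] unfolding a_def by linarith+
  have t: "log 2 (real n) powr (3/4) \<le> t n" "t n \<le> log 2 (real n) powr (3/4) + 1" for n
    using powr_ge_zero[of "log 2 (real n)" "3/4"] unfolding t_def by linarith+
  let ?l = "\<lambda>n. 2 - 4 * (real n ^ (3 * k n) * exp (- (real n - 3 * real (k n)) / 2 ^ k n))
      - 2 * (real n ^ a n * (1/2) ^ (a n choose 2))
      - 4 / k n * (t n + a n * (2 ^ a n * (1 - s/2) ^ (t n choose 2)))"
  have "?l \<longlonglongrightarrow> 2 - 4 * 0 - 2 * 0 - 0"
    using s by (intro tendsto_diff tendsto_mult tendsto_const tendsto_prob_not_extendable
        tendsto_prob_large_independent_set tendsto_mean_overlap k a t) auto
  then show "?l \<longlonglongrightarrow> 2" by simp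
  \<comment> \<open>Ensures that the floor defining \<open>k n\<close> is at least 1.\<close>
  have "\<forall>\<^sub>F n in sequentially. 4 \<le> log 2 (real n)" by real_asymp
  then show "\<forall>\<^sub>F n in sequentially. ?l n \<le> measure_pmf.expectation (resampled_pair n s)
      (\<lambda>(g, g'). (w2 n (hardcore n g) (hardcore n g'))\<^sup>2)"
    using eventually_ge_at_top[of 2]
  proof eventually_elim
    case (elim n)
    then have "0 < k n" unfolding k_def by linarith
    then show ?case using elim s by (intro expectation_w2_power2_ge) auto
  qed
  show "\<forall>\<^sub>F n in sequentially. measure_pmf.expectation (resampled_pair n s)
      (\<lambda>(g, g'). (w2 n (hardcore n g) (hardcore n g'))\<^sup>2) \<le> 2"
    using eventually_ge_at_top[of 1] by eventually_elim (rule expectation_w2_power2_le)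
qed

theorem theorem1p2:
  "((\<lambda>s::real. liminf (\<lambda>n::nat. ereal (measure_pmf.expectation (resampled_pair n s)
        (\<lambda>(g, g'). (w2 n (hardcore n g) (hardcore n g'))\<^sup>2))))
    \<longlongrightarrow> (2::ereal)) (at 0 within {0<..<1})"
proof (rule tendsto_eventually)
  \<comment> \<open>For every fixed s in (0,1) the expectation converges to 2, so the function of s
    is constant on the punctured neighbourhood and the outer limit is immediate.\<close>
  have "liminf (\<lambda>n. ereal (measure_pmf.expectation (resampled_pair n s)
      (\<lambda>(g, g'). (w2 n (hardcore n g) (hardcore n g'))\<^sup>2))) = 2" if "s \<in> {0<..<1}" for s
  proof (rule lim_imp_Liminf)
    show "(\<lambda>n. ereal (measure_pmf.expectation (resampled_pair n s)
        (\<lambda>(g, g'). (w2 n (hardcore n g) (hardcore n g'))\<^sup>2))) \<longlonglongrightarrow> 2"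
      using tendsto_ereal[OF tendsto_expectation_w2_power2] that by simp
  qed simp
  then show "\<forall>\<^sub>F s in at 0 within {0<..<1}. liminf (\<lambda>n. ereal (measure_pmf.expectation
      (resampled_pair n s) (\<lambda>(g, g'). (w2 n (hardcore n g) (hardcore n g'))\<^sup>2))) = 2"
    by (auto simp: eventually_at_filter)
qed

end
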